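(* Let $k\ge 0$, and let $$\Sigma^{(k)}=\{\sigma\in\mathcal{S}_{2k+2} : \sigma(i)>\sigma(j)\text{ for every } i,j\in\{1,\dots,2k+2\}\text{ with } i\le k+1<j\}.$$ Then for every $n\ge1$, $$\mathcal{A}^{(k)}_n=\mathcal{S}_n(\Sigma^{(k)}).$$
   Context: $\mathcal{S}_n$ is the set of permutations of $\{1,\dots,n\}$. For $k\ge0$, the set of $k$-almost-increasing permutations is $$\mathcal{A}^{(k)}_n=\{\pi\in\mathcal{S}_n : |\{j : j\le i\text{ and }\pi(j)>i\}|\le k\text{ for every } i\in\{1,\dots,n\}\}.$$ A permutation $\pi\in\mathcal{S}_n$ avoids $\sigma\in\mathcal{S}_m$ if no subsequence of $\pi(1)\pi(2)\cdots\pi(n)$ has its entries in the same relative order as the entries of $\sigma$. For a set $\Sigma$ of permutations, $\mathcal{S}_n(\Sigma)$ is the set of $\pi\in\mathcal{S}_n$ that avoid every $\sigma\in\Sigma$. *)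

theory Defs
  imports Main "HOL-Combinatorics.Permutations"
begin

definition perms :: "nat \<Rightarrow> (nat \<Rightarrow> nat) set" where
  "perms n = {\<pi>. \<pi> permutes {1..n}}"

definition almost_increasing :: "nat \<Rightarrow> nat \<Rightarrow> (nat \<Rightarrow> nat) set" where
  "almost_increasing k n =
     {\<pi> \<in> perms n. \<forall>i\<in>{1..n}. card {j \<in> {1..n}. j \<le> i \<and> \<pi> j > i} \<le> k}"

text \<open>
  The map \<open>f\<close> selects the positions of an occurrence of \<open>\<sigma>\<close> in \<open>\<pi>\<close>.
  The sizes are explicit because a function that permutes \<open>{1..m}\<close> is the identity
  elsewhere and so does not determine \<open>m\<close>.
\<close>

definition contains_pattern ::
    "nat \<Rightarrow> (nat \<Rightarrow> nat) \<Rightarrow> nat \<Rightarrow> (nat \<Rightarrow> nat) \<Rightarrow> bool" where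
  "contains_pattern n \<pi> m \<sigma> \<longleftrightarrow>
     (\<exists>f. strict_mono_on {1..m} f \<and> f ` {1..m} \<subseteq> {1..n} \<and>
          (\<forall>a\<in>{1..m}. \<forall>b\<in>{1..m}. \<pi> (f a) < \<pi> (f b) \<longleftrightarrow> \<sigma> a < \<sigma> b))"

text \<open>A set of patterns, possibly of different sizes, is a set of pairs \<open>(m, \<sigma>)\<close> with
  \<open>\<sigma> \<in> perms m\<close>.\<close>

definition avoiders :: "nat \<Rightarrow> (nat \<times> (nat \<Rightarrow> nat)) set \<Rightarrow> (nat \<Rightarrow> nat) set" where
  "avoiders n \<Sigma> = {\<pi> \<in> perms n. \<forall>(m, \<sigma>)\<in>\<Sigma>. \<not> contains_pattern n \<pi> m \<sigma>}"

definition Sigma_patterns :: "nat \<Rightarrow> (nat \<times> (nat \<Rightarrow> nat)) set" where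
  "Sigma_patterns k =
     {2 * k + 2} \<times>
     {\<sigma> \<in> perms (2 * k + 2).
        \<forall>i\<in>{1..2 * k + 2}. \<forall>j\<in>{1..2 * k + 2}. i \<le> k + 1 \<and> k + 1 < j \<longrightarrow> \<sigma> i > \<sigma> j}"

end

theory Submission
  imports Defs
begin

text \<open>
  As \<open>\<pi>\<close> is a bijection, as many entries cross a cut \<open>i\<close> upwards
  (\<open>j \<le> i < \<pi> j\<close>) as downwards (\<open>\<pi> j \<le> i < j\<close>). If more than \<open>k\<close> entries cross upwards at some
  cut, then \<open>k + 1\<close> of them followed by \<open>k + 1\<close> downward ones form a pattern of the forbidden
  kind. Conversely, given an occurrence of such a pattern, cut at the position \<open>p\<close> of its
  \<open>(k + 1)\<close>-st entry: if the entries of its left half all exceed \<open>p\<close> they cross upwards,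
  and otherwise all entries of its right half are below \<open>p\<close> and cross downwards.
\<close>

text \<open>Both sets are differences of the set of positions up to \<open>i\<close> and the set of
  positions whose value is at most \<open>i\<close>. Since \<open>\<pi>\<close> maps the second of
  these bijectively onto the first, they have equal size, and removing their common part keeps the
  sizes equal.\<close>

lemma card_crossing_eq:
  fixes i n :: nat
  assumes "\<pi> permutes {1..n}" and "i \<le> n"
  shows "card {j \<in> {1..n}. j \<le> i \<and> \<pi> j > i} = card {j \<in> {1..n}. j > i \<and> \<pi> j \<le> i}"
proof -
  let ?A = "{j \<in> {1..n}. j \<le> i}" and ?B = "{j \<in> {1..n}. \<pi> j \<le> i}"
  have "\<pi> ` ?B = ?A"
  proof
    show "\<pi> ` ?B \<subseteq> ?A"
      using permutes_in_image[OF assms(1)] by blast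
    show "?A \<subseteq> \<pi> ` ?B"
    proof
      fix y assume "y \<in> ?A"
      moreover from this obtain x where "x \<in> {1..n}" "y = \<pi> x"
        using permutes_image[OF assms(1)] by blast
      ultimately show "y \<in> \<pi> ` ?B"
        by blast
    qed
  qed
  moreover have "inj_on \<pi> ?B"
    using permutes_inj[OF assms(1)] by (rule inj_on_subset) simp
  ultimately have "card ?A = card ?B"
    using card_image[of \<pi> ?B] by (simp only:)
  then have "card (?A - ?B) = card (?B - ?A)"
    by (intro antisym card_le_sym_Diff) simp_all
  moreover have "?A - ?B = {j \<in> {1..n}. j \<le> i \<and> \<pi> j > i}"
    and "?B - ?A = {j \<in> {1..n}. j > i \<and> \<pi> j \<le> i}"
    by auto
  ultimately show ?thesis
    by (simp only:)
qed

text \<open>Sets of positions are obtained by counting only; listing them in increasing order gives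
  the position maps that \<open>contains_pattern\<close> asks for.\<close>

lemma ex_strict_mono_enumeration:
  fixes S :: "nat set"
  assumes "finite S"
  shows "\<exists>f. strict_mono_on {1..card S} f \<and> f ` {1..card S} = S"
proof -
  let ?xs = "sorted_list_of_set S"
  let ?f = "\<lambda>a. ?xs ! (a - 1)"
  have "strict_mono_on {1..card S} ?f"
    by (rule strict_mono_onI)
      (auto intro!: sorted_wrt_nth_less[OF strict_sorted_list_of_set])
  moreover have "?f ` {1..card S} = S"
  proof -
    have "(\<lambda>a. a - 1) ` {1..card S} = {..<card S}"
    proof
      show "{..<card S} \<subseteq> (\<lambda>a. a - 1) ` {1..card S}"
      proof
        fix x assume "x \<in> {..<card S}"
        then show "x \<in> (\<lambda>a. a - 1) ` {1..card S}"
          by (intro image_eqI[of _ _ "Suc x"]) auto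
      qed
    qed auto
    then have "?f ` {1..card S} = (!) ?xs ` {..<length ?xs}"
      using image_image[of "(!) ?xs" "\<lambda>a. a - 1" "{1..card S}"] by simp
    also have "\<dots> = set ?xs"
      by (auto simp: set_conv_nth)
    also have "\<dots> = S"
      using assms by simp
    finally show ?thesis .
  qed
  ultimately show ?thesis
    by blast
qed

text \<open>Replacing each value of \<open>g\<close> by its rank preserves the order, and the ranks
  of distinct values fill \<open>{1..m}\<close>. For the values of \<open>\<pi>\<close> at chosen
  positions, this yields the pattern they form.\<close>

lemma ex_standardization:
  fixes g :: "nat \<Rightarrow> nat"
  assumes "inj_on g {1..m}"
  shows "\<exists>\<sigma>. \<sigma> permutes {1..m} \<and> (\<forall>a\<in>{1..m}. \<forall>b\<in>{1..m}. \<sigma> a < \<sigma> b \<longleftrightarrow> g a < g b)"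
proof -
  \<comment> \<open>Counting with \<open>\<le>\<close> makes the ranks start at 1; the identity
    elsewhere is what \<open>permutes\<close> demands.\<close>
  define \<sigma> where "\<sigma> a = (if a \<in> {1..m} then card {b \<in> {1..m}. g b \<le> g a} else a)" for a
  have mono: "\<sigma> a < \<sigma> b" if "a \<in> {1..m}" "b \<in> {1..m}" "g a < g b" for a b
  proof -
    \<comment> \<open>The inclusion is strict because \<open>b\<close> itself is counted on the
      right only.\<close>
    have "{c \<in> {1..m}. g c \<le> g a} \<subset> {c \<in> {1..m}. g c \<le> g b}"
      using that by (auto simp: psubset_eq set_eq_iff intro!: exI[of _ b])
    then show ?thesis
      using that by (simp add: \<sigma>_def psubset_card_mono)
  qed
  have iff: "\<sigma> a < \<sigma> b \<longleftrightarrow> g a < g b" if "a \<in> {1..m}" "b \<in> {1..m}" for a b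
  proof (cases "g a" "g b" rule: linorder_cases)
    case equal
    then show ?thesis
      using assms that by (auto dest: inj_onD)
  qed (use mono[of a b] mono[of b a] that in auto)
  have inj: "inj_on \<sigma> {1..m}"
  proof (rule inj_onI)
    fix a b assume ab: "a \<in> {1..m}" "b \<in> {1..m}" "\<sigma> a = \<sigma> b"
    then have "g a = g b"
      using iff[of a b] iff[of b a] by simp
    then show "a = b"
      using assms ab by (auto dest: inj_onD)
  qed
  have "\<sigma> ` {1..m} \<subseteq> {1..m}"
  proof
    fix y assume "y \<in> \<sigma> ` {1..m}"
    then obtain a where a: "a \<in> {1..m}" and y: "y = card {b \<in> {1..m}. g b \<le> g a}"
      by (auto simp: \<sigma>_def)
    have "y \<le> card {1..m}"
      unfolding y by (rule card_mono) auto
    moreover have "y > 0"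
      unfolding y using a by (auto simp: card_gt_0_iff)
    ultimately show "y \<in> {1..m}"
      by simp
  qed
  \<comment> \<open>An injective map of a finite set into itself is onto.\<close>
  then have "bij_betw \<sigma> {1..m} {1..m}"
    using inj by (simp add: bij_betw_def endo_inj_surj)
  then have "\<sigma> permutes {1..m}"
    by (rule bij_imp_permutes) (auto simp: \<sigma>_def)
  then show ?thesis
    using iff by blast
qed

lemma contains_Sigma_pattern_if_crossing:
  assumes \<pi>: "\<pi> permutes {1..n}" and i: "i \<le> n"
    and crossing: "card {j \<in> {1..n}. j \<le> i \<and> \<pi> j > i} > k"
  shows "\<exists>(m, \<sigma>)\<in>Sigma_patterns k. contains_pattern n \<pi> m \<sigma>"
proof -
  let ?m = "2 * k + 2"
  let ?U = "{j \<in> {1..n}. j \<le> i \<and> \<pi> j > i}" and ?D = "{j \<in> {1..n}. j > i \<and> \<pi> j \<le> i}"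
  have "k + 1 \<le> card ?U"
    using crossing by simp
  then obtain P where P: "P \<subseteq> ?U" "card P = k + 1" "finite P"
    by (rule obtain_subset_with_card_n)
  have "k + 1 \<le> card ?D"
    using crossing card_crossing_eq[OF \<pi> i] by simp
  then obtain Q where Q: "Q \<subseteq> ?D" "card Q = k + 1" "finite Q"
    by (rule obtain_subset_with_card_n)
  obtain p where p: "strict_mono_on {1..k + 1} p" "p ` {1..k + 1} = P"
    using ex_strict_mono_enumeration[OF P(3)] unfolding P(2) by blast
  obtain q where q: "strict_mono_on {1..k + 1} q" "q ` {1..k + 1} = Q"
    using ex_strict_mono_enumeration[OF Q(3)] unfolding Q(2) by blast
  \<comment> \<open>\<open>f\<close> lists \<open>P\<close> and then \<open>Q\<close>. It increases
    across the junction because \<open>P\<close> lies at positions up to \<open>i\<close> and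
    \<open>Q\<close> beyond \<open>i\<close>.\<close>
  define f where "f a = (if a \<le> k + 1 then p a else q (a - (k + 1)))" for a
  have fP: "f a \<in> P" if "a \<in> {1..?m}" "a \<le> k + 1" for a
    using that p(2) by (auto simp: f_def)
  have fQ: "f a \<in> Q" if "a \<in> {1..?m}" "k + 1 < a" for a
  proof -
    have "a - (k + 1) \<in> {1..k + 1}"
      using that by auto
    then show ?thesis
      using that q(2) by (auto simp: f_def)
  qed
  have f: "strict_mono_on {1..?m} f"
  proof (rule strict_mono_onI)
    fix a b assume ab: "a \<in> {1..?m}" "b \<in> {1..?m}" "a < b"
    consider "b \<le> k + 1" | "a \<le> k + 1" "k + 1 < b" | "k + 1 < a"
      by linarith
    then show "f a < f b"
    proof cases
      case 1
      then show ?thesis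
        using ab by (auto simp: f_def intro!: strict_mono_onD[OF p(1)])
    next
      case 2
      then show ?thesis
        using fP[OF ab(1)] fQ[OF ab(2)] P(1) Q(1) by (auto dest!: subsetD)
    next
      case 3
      then show ?thesis
        using ab by (auto simp: f_def intro!: strict_mono_onD[OF q(1)])
    qed
  qed
  have range: "f ` {1..?m} \<subseteq> {1..n}"
  proof
    fix y assume "y \<in> f ` {1..?m}"
    then obtain a where "a \<in> {1..?m}" "y = f a"
      by blast
    then have "y \<in> P \<or> y \<in> Q"
      using fP[of a] fQ[of a] by (cases "a \<le> k + 1") simp_all
    then show "y \<in> {1..n}"
      using P(1) Q(1) by auto
  qed
  have "inj_on (\<pi> \<circ> f) {1..?m}"
    by (rule comp_inj_on[OF strict_mono_on_imp_inj_on[OF f] permutes_inj_on[OF \<pi>]])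
  then obtain \<sigma> where \<sigma>: "\<sigma> permutes {1..?m}"
    and iff: "\<forall>a\<in>{1..?m}. \<forall>b\<in>{1..?m}. \<sigma> a < \<sigma> b \<longleftrightarrow> \<pi> (f a) < \<pi> (f b)"
    using ex_standardization[of "\<pi> \<circ> f" ?m] by auto
  have "\<sigma> a > \<sigma> b" if "a \<in> {1..?m}" "b \<in> {1..?m}" "a \<le> k + 1" "k + 1 < b" for a b
  proof -
    \<comment> \<open>The cut \<open>i\<close> also separates the values: those at \<open>P\<close>
      exceed it, those at \<open>Q\<close> do not.\<close>
    have "\<pi> (f b) \<le> i" "i < \<pi> (f a)"
      using fP[of a] fQ[of b] that P(1) Q(1) by auto
    then show ?thesis
      using iff that by auto
  qed
  then have "(?m, \<sigma>) \<in> Sigma_patterns k"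
    using \<sigma> by (simp add: Sigma_patterns_def perms_def)
  moreover have "contains_pattern n \<pi> ?m \<sigma>"
    unfolding contains_pattern_def using f range iff by blast
  ultimately show ?thesis
    by blast
qed

lemma crossing_if_contains_Sigma_pattern:
  assumes \<pi>: "\<pi> permutes {1..n}"
    and \<sigma>: "(m, \<sigma>) \<in> Sigma_patterns k" "contains_pattern n \<pi> m \<sigma>"
  shows "\<exists>i\<in>{1..n}. card {j \<in> {1..n}. j \<le> i \<and> \<pi> j > i} > k"
proof -
  have m: "m = 2 * k + 2"
    and desc: "\<And>a b. a \<in> {1..m} \<Longrightarrow> b \<in> {1..m} \<Longrightarrow> a \<le> k + 1 \<Longrightarrow> k + 1 < b \<Longrightarrow> \<sigma> b < \<sigma> a"
    using \<sigma>(1) by (auto simp: Sigma_patterns_def)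
  obtain f where f: "strict_mono_on {1..m} f" "f ` {1..m} \<subseteq> {1..n}"
    and iff: "\<forall>a\<in>{1..m}. \<forall>b\<in>{1..m}. \<pi> (f a) < \<pi> (f b) \<longleftrightarrow> \<sigma> a < \<sigma> b"
    using \<sigma>(2) by (auto simp: contains_pattern_def)
  have inj: "inj_on f A" if "A \<subseteq> {1..m}" for A
    using strict_mono_on_imp_inj_on[OF f(1)] that by (rule inj_on_subset)
  \<comment> \<open>The non-strict form is used because the position \<open>f (k + 1)\<close> itself
    counts as lying before the cut.\<close>
  have le: "f a \<le> f b" if "a \<in> {1..m}" "b \<in> {1..m}" "a \<le> b" for a b
    using strict_mono_onD[OF f(1), of a b] that by (cases "a = b") auto
  let ?p = "f (k + 1)"
  have p: "?p \<in> {1..n}"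
    using m by (intro subsetD[OF f(2)] imageI) auto
  have "k < card {j \<in> {1..n}. j \<le> ?p \<and> \<pi> j > ?p}"
  proof (cases "\<forall>a\<in>{1..k + 1}. \<pi> (f a) > ?p")
    case True
    have "f ` {1..k + 1} \<subseteq> {j \<in> {1..n}. j \<le> ?p \<and> \<pi> j > ?p}"
    proof
      fix y assume "y \<in> f ` {1..k + 1}"
      then obtain a where a: "a \<in> {1..k + 1}" "y = f a"
        by blast
      then have "a \<in> {1..m}"
        using m by auto
      moreover from this have "f a \<in> {1..n}"
        using f(2) by blast
      ultimately show "y \<in> {j \<in> {1..n}. j \<le> ?p \<and> \<pi> j > ?p}"
        using a True le[of a "k + 1"] m by auto
    qed
    then have "card (f ` {1..k + 1}) \<le> card {j \<in> {1..n}. j \<le> ?p \<and> \<pi> j > ?p}"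
      by (intro card_mono) auto
    moreover have "card (f ` {1..k + 1}) = k + 1"
      using m by (subst card_image[OF inj]) auto
    ultimately show ?thesis
      by simp
  next
    case False
    \<comment> \<open>This single left entry of value at most \<open>?p\<close> bounds every right
      entry, since the pattern puts its whole right half below each left entry.\<close>
    then obtain a where a: "a \<in> {1..k + 1}" "\<pi> (f a) \<le> ?p"
      by (auto simp: not_less)
    have "f ` {k + 2..m} \<subseteq> {j \<in> {1..n}. j > ?p \<and> \<pi> j \<le> ?p}"
    proof
      fix y assume "y \<in> f ` {k + 2..m}"
      then obtain b where b: "b \<in> {k + 2..m}" "y = f b"
        by blast
      have ab: "a \<in> {1..m}" "b \<in> {1..m}" "a \<le> k + 1" "k + 1 < b"
        using a b m by auto
      then have "\<pi> (f b) < \<pi> (f a)"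
        using iff desc by blast
      moreover have "?p < f b"
        using ab m by (intro strict_mono_onD[OF f(1)]) auto
      moreover have "f b \<in> {1..n}"
        using f(2) ab by blast
      ultimately show "y \<in> {j \<in> {1..n}. j > ?p \<and> \<pi> j \<le> ?p}"
        using a b by auto
    qed
    then have "card (f ` {k + 2..m}) \<le> card {j \<in> {1..n}. j > ?p \<and> \<pi> j \<le> ?p}"
      by (intro card_mono) auto
    moreover have "card (f ` {k + 2..m}) = k + 1"
      using m by (subst card_image[OF inj]) auto
    \<comment> \<open>The \<open>k + 1\<close> downward crossings found here force as many upward
      ones.\<close>
    ultimately show ?thesis
      using card_crossing_eq[OF \<pi>, of ?p] p by simp
  qed
  then show ?thesis
    using p by blast
qed

theorem lemma2p2:
  fixes k n :: nat
  assumes "n \<ge> 1"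
  shows "almost_increasing k n = avoiders n (Sigma_patterns k)"
proof -
  have "(\<forall>i\<in>{1..n}. card {j \<in> {1..n}. j \<le> i \<and> \<pi> j > i} \<le> k) \<longleftrightarrow>
      (\<forall>(m, \<sigma>)\<in>Sigma_patterns k. \<not> contains_pattern n \<pi> m \<sigma>)"
    (is "?crossing \<longleftrightarrow> ?avoids") if \<pi>: "\<pi> permutes {1..n}" for \<pi>
  proof
    assume ?crossing
    then show ?avoids
      using crossing_if_contains_Sigma_pattern[OF \<pi>] by (blast dest: leD)
  next
    assume avoids: ?avoids
    show ?crossing
    proof (rule ballI, rule leI, rule notI)
      fix i assume "i \<in> {1..n}" "k < card {j \<in> {1..n}. j \<le> i \<and> \<pi> j > i}"
      then have "\<exists>(m, \<sigma>)\<in>Sigma_patterns k. contains_pattern n \<pi> m \<sigma>"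
        by (intro contains_Sigma_pattern_if_crossing[OF \<pi>]) simp_all
      with avoids show False
        by blast
    qed
  qed
  then show ?thesis
    unfolding almost_increasing_def avoiders_def perms_def by blast
qed

end
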